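(* Let $\gamma_P:\mathbb{R}^n\to\mathbb{R}$ be continuous and concave, let $\rho_P:\mathbb{R}^n\to\mathbb{R}$ be continuous and convex, let $(\rho_P^{\text{ref}},\gamma_P^{\text{ref}})\in\mathbb{R}^2$, and let $\Delta$, $X$ and $A$ be as defined in the context. Let $x_A$ be any global solution of the problem of maximizing $A(x)$ over $x\in X$, and suppose that $A(x_A)>0$. Then $x_A$ is a global Pareto optimum of the two-objective problem of simultaneously maximizing $\gamma_P(x)$ and minimizing $\rho_P(x)$ over $x\in\Delta$.
   Context: $\Delta=\{x\in\mathbb{R}^n : x\ge 0,\ \sum_{i=1}^n x_i=1\}$ is the unit simplex (feasible portfolios). $\gamma_P$ is the gain and $\rho_P$ the risk; $(\rho_P^{\text{ref}},\gamma_P^{\text{ref}})$ is a fixed reference point. $X=\{x\in\Delta : \gamma_P(x)\ge\gamma_P^{\text{ref}},\ \rho_P(x)\le\rho_P^{\text{ref}}\}$ and $A(x)=\big(\gamma_P(x)-\gamma_P^{\text{ref}}\big)\big(\rho_P^{\text{ref}}-\rho_P(x)\big)$. A global solution of the maximization problem is a point $x_A\in X$ with $A(x_A)\ge A(x)$ for all $x\in X$. A point $\bar x\in\Delta$ is a global Pareto optimum of the two-objective problem if there is no $x\in\Delta$ with $\gamma_P(x)\ge\gamma_P(\bar x)$ and $\rho_P(x)\le\rho_P(\bar x)$, with at least one of these two inequalities strict. *)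

theory Defs
  imports "HOL-Analysis.Analysis"
begin

definition portfolios :: "(real ^ 'n) set" where
  "portfolios = {x. (\<forall>i. 0 \<le> x $ i) \<and> (\<Sum>i\<in>UNIV. x $ i) = 1}"

text \<open>
  Throughout, \<open>\<gamma>\<close> is the gain, \<open>\<rho>\<close> the risk, and \<open>(\<rho>ref, \<gamma>ref)\<close> the reference point.
\<close>

definition feasible_set ::
    "(real ^ 'n \<Rightarrow> real) \<Rightarrow> (real ^ 'n \<Rightarrow> real) \<Rightarrow> real \<Rightarrow> real \<Rightarrow> (real ^ 'n) set" where
  "feasible_set \<gamma> \<rho> \<gamma>ref \<rho>ref = {x \<in> portfolios. \<gamma> x \<ge> \<gamma>ref \<and> \<rho> x \<le> \<rho>ref}"

definition area ::
    "(real ^ 'n \<Rightarrow> real) \<Rightarrow> (real ^ 'n \<Rightarrow> real) \<Rightarrow> real \<Rightarrow> real \<Rightarrow> real ^ 'n \<Rightarrow> real" where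
  "area \<gamma> \<rho> \<gamma>ref \<rho>ref x = (\<gamma> x - \<gamma>ref) * (\<rho>ref - \<rho> x)"

definition global_maximizer :: "('a \<Rightarrow> real) \<Rightarrow> 'a set \<Rightarrow> 'a \<Rightarrow> bool" where
  "global_maximizer f S z \<longleftrightarrow> z \<in> S \<and> (\<forall>x\<in>S. f x \<le> f z)"

definition global_pareto_optimum ::
    "(real ^ 'n \<Rightarrow> real) \<Rightarrow> (real ^ 'n \<Rightarrow> real) \<Rightarrow> real ^ 'n \<Rightarrow> bool" where
  "global_pareto_optimum \<gamma> \<rho> z \<longleftrightarrow> z \<in> portfolios \<and>
     \<not> (\<exists>x\<in>portfolios. \<gamma> x \<ge> \<gamma> z \<and> \<rho> x \<le> \<rho> z \<and> (\<gamma> x > \<gamma> z \<or> \<rho> x < \<rho> z))"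

end

theory Submission
  imports Defs
begin

text \<open>
  The area is the product of the gain margin \<open>\<gamma> x - \<gamma>ref\<close> and the risk margin
  \<open>\<rho>ref - \<rho> x\<close>, and both margins are nonnegative on the feasible set. A positive area
  therefore makes both margins of the maximizer positive. A portfolio that dominates the
  maximizer has margins at least as large, so it is again feasible, and one of them is strictly
  larger; as the other factor is positive, its area is strictly larger too, which contradicts
  maximality.
\<close>

lemma mult_less_mult_if_one_factor_less:
  fixes a b c d :: "'a :: linordered_semidom"
  assumes "0 < a" and "0 < b" and "a \<le> c" and "b \<le> d" and "a < c \<or> b < d"
  shows "a * b < c * d"
  using assms by (auto intro: mult_less_le_imp_less mult_le_less_imp_less)

theorem proposition2p1:
  fixes \<gamma> \<rho> :: "real ^ 'n \<Rightarrow> real"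
    and \<gamma>ref \<rho>ref :: real
    and x\<^sub>A :: "real ^ 'n"
  assumes "continuous_on UNIV \<gamma>" and "concave_on UNIV \<gamma>"
    and "continuous_on UNIV \<rho>" and "convex_on UNIV \<rho>"
    and "global_maximizer (area \<gamma> \<rho> \<gamma>ref \<rho>ref) (feasible_set \<gamma> \<rho> \<gamma>ref \<rho>ref) x\<^sub>A"
    and "area \<gamma> \<rho> \<gamma>ref \<rho>ref x\<^sub>A > 0"
  shows "global_pareto_optimum \<gamma> \<rho> x\<^sub>A"
proof -
  have feasible: "x\<^sub>A \<in> portfolios" "\<gamma>ref \<le> \<gamma> x\<^sub>A" "\<rho> x\<^sub>A \<le> \<rho>ref"
    using assms(5) by (auto simp: global_maximizer_def feasible_set_def)
  have maximal: "area \<gamma> \<rho> \<gamma>ref \<rho>ref x \<le> area \<gamma> \<rho> \<gamma>ref \<rho>ref x\<^sub>A"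
      if "x \<in> feasible_set \<gamma> \<rho> \<gamma>ref \<rho>ref" for x
    using assms(5) that by (simp add: global_maximizer_def)
  \<comment> \<open>Feasibility excludes the case in which the positive product has two negative factors.\<close>
  have margins: "0 < \<gamma> x\<^sub>A - \<gamma>ref" "0 < \<rho>ref - \<rho> x\<^sub>A"
    using assms(6) feasible by (auto simp: area_def zero_less_mult_iff)
  have "\<not> (\<gamma> x > \<gamma> x\<^sub>A \<or> \<rho> x < \<rho> x\<^sub>A)"
    if "x \<in> portfolios" "\<gamma> x \<ge> \<gamma> x\<^sub>A" "\<rho> x \<le> \<rho> x\<^sub>A" for x
  proof
    assume "\<gamma> x > \<gamma> x\<^sub>A \<or> \<rho> x < \<rho> x\<^sub>A"
    then have "area \<gamma> \<rho> \<gamma>ref \<rho>ref x\<^sub>A < area \<gamma> \<rho> \<gamma>ref \<rho>ref x"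
      unfolding area_def using margins that
      by (intro mult_less_mult_if_one_factor_less) auto
    moreover have "x \<in> feasible_set \<gamma> \<rho> \<gamma>ref \<rho>ref"
      using that feasible by (simp add: feasible_set_def)
    ultimately show False
      using maximal[of x] by simp
  qed
  then show ?thesis
    using feasible(1) by (auto simp: global_pareto_optimum_def)
qed

end
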